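(* Let $K$ be a $k$-dimensional USO and $h\in[k]$ some dimension. Let $U\subset\{0,1\}^k$ be the set of vertices in the upper $h$-facet that are incident to an upwards $h$-edge of $K$, and let $L=\{v\oplus h: v\in U\}$ be the set of their neighbors in the lower $h$-facet. Let $K_U$ and $K_L$ be the (oriented) subgraphs induced by $U$ and by $L$, respectively. Then swapping these two subgraphs yields an orientation $K'$ of $Q_k$, and $K'$ is a USO. Here swapping means that $K'$ is the function given by $$K'(v)=\begin{cases}K(v\oplus h) & \text{if } v\in U\cup L,\\ K(v)&\text{otherwise.}\end{cases}$$
   Context: $[k]=\{1,\ldots,k\}$. $Q_k$ is the $k$-dimensional hypercube graph with vertex set $\{0,1\}^k$; $v\oplus i$ denotes the neighbor of $v$ differing from $v$ exactly in coordinate $i$, and $\{v,v\oplus i\}$ is called an $i$-edge. The upper (lower) $h$-facet is the subgraph induced by the vertices $v$ with $v_h=1$ ($v_h=0$). An orientation $O$ of $Q_k$ directs every edge; it is identified with the function $O:\{0,1\}^k\to\{0,1\}^k$ where $O(v)_i=1$ if the edge $\{v,v\oplus i\}$ is directed upwards (from its endpoint in the lower $i$-facet to its endpoint in the upper $i$-facet) and $O(v)_i=0$ if it is directed downwards. Thus a function $O:\{0,1\}^k\to\{0,1\}^k$ is an orientation if and only if $O(v)_i=O(v\oplus i)_i$ for all $v$ and $i$. A face is the subgraph induced by all vertices that agree with a fixed string $f\in\{0,1,*\}^k$ on the non-$*$ positions. $O$ is a Unique Sink Orientation (USO) if every face contains exactly one vertex with no outgoing edges inside that face. The operation taking $K$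 to $K'$ is called a partial swap in dimension $h$. *)

theory Defs
  imports "HOL-Library.FuncSet"
begin

text \<open>
  Bits are booleans (1 is \<^const>\<open>True\<close>). Elements of \<open>{0,1}\<^sup>k\<close> are
  functions on \<open>{1..k}\<close>, extended by \<^const>\<open>undefined\<close> so that distinct
  functions are distinct vertices.
\<close>

definition cube :: "nat \<Rightarrow> (nat \<Rightarrow> bool) set" where
  "cube k = {1..k} \<rightarrow>\<^sub>E (UNIV :: bool set)"

definition flip :: "(nat \<Rightarrow> bool) \<Rightarrow> nat \<Rightarrow> (nat \<Rightarrow> bool)" where
  "flip v i = v(i := \<not> v i)"

definition upper_facet :: "nat \<Rightarrow> nat \<Rightarrow> (nat \<Rightarrow> bool) set" where
  "upper_facet k h = {v \<in> cube k. v h}"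

text \<open>
  The bit \<open>X v i\<close> says whether the edge between \<open>v\<close> and \<open>flip v i\<close> points upwards.
  It is not an out-map: whether that edge leaves \<open>v\<close> also depends on \<open>v i\<close>, see \<open>arc\<close>.
  Values of \<open>X\<close> outside the cube are irrelevant.
\<close>

definition orientation :: "nat \<Rightarrow> ((nat \<Rightarrow> bool) \<Rightarrow> (nat \<Rightarrow> bool)) \<Rightarrow> bool" where
  "orientation k X \<longleftrightarrow>
     X \<in> cube k \<rightarrow> cube k \<and> (\<forall>v\<in>cube k. \<forall>i\<in>{1..k}. X v i = X (flip v i) i)"

text \<open>
  The edge from \<open>v\<close> to \<open>w\<close> is directed from \<open>v\<close> to \<open>w\<close>: either it points upwards and
  \<open>v\<close> is its lower endpoint, or it points downwards and \<open>v\<close> is its upper endpoint.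
\<close>

definition arc :: "nat \<Rightarrow> ((nat \<Rightarrow> bool) \<Rightarrow> (nat \<Rightarrow> bool)) \<Rightarrow>
    (nat \<Rightarrow> bool) \<Rightarrow> (nat \<Rightarrow> bool) \<Rightarrow> bool" where
  "arc k X v w \<longleftrightarrow> (\<exists>i\<in>{1..k}. w = flip v i \<and> (X v i \<and> \<not> v i \<or> \<not> X v i \<and> v i))"

text \<open>Strings over \<open>{0,1,*}\<close>: \<^const>\<open>None\<close> stands for \<open>*\<close>.\<close>

definition face_strings :: "nat \<Rightarrow> (nat \<Rightarrow> bool option) set" where
  "face_strings k = {1..k} \<rightarrow>\<^sub>E (UNIV :: bool option set)"

definition face :: "nat \<Rightarrow> (nat \<Rightarrow> bool option) \<Rightarrow> (nat \<Rightarrow> bool) set" where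
  "face k f = {v \<in> cube k. \<forall>i\<in>{1..k}. f i \<noteq> None \<longrightarrow> f i = Some (v i)}"

definition sink_in :: "nat \<Rightarrow> ((nat \<Rightarrow> bool) \<Rightarrow> (nat \<Rightarrow> bool)) \<Rightarrow>
    (nat \<Rightarrow> bool) set \<Rightarrow> (nat \<Rightarrow> bool) \<Rightarrow> bool" where
  "sink_in k X F v \<longleftrightarrow> v \<in> F \<and> \<not> (\<exists>w\<in>F. arc k X v w)"

definition USO :: "nat \<Rightarrow> ((nat \<Rightarrow> bool) \<Rightarrow> (nat \<Rightarrow> bool)) \<Rightarrow> bool" where
  "USO k X \<longleftrightarrow> orientation k X \<and> (\<forall>f\<in>face_strings k. \<exists>!v. sink_in k X (face k f) v)"

lemma flip_eq_iff: "flip v i = flip v j \<longleftrightarrow> i = j"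
  unfolding flip_def by (metis fun_upd_apply)

lemma flip_flip [simp]: "flip (flip v i) i = v"
  by (simp add: flip_def)

lemma flip_in_cube: "v \<in> cube k \<Longrightarrow> i \<in> {1..k} \<Longrightarrow> flip v i \<in> cube k"
  by (auto simp: cube_def flip_def PiE_iff extensional_def)

lemma arc_flip_iff:
  assumes "i \<in> {1..k}"
  shows "arc k X v (flip v i) \<longleftrightarrow> (X v i \<noteq> v i)"
  using assms by (auto simp: arc_def flip_eq_iff)

lemma arc_exactly_one_direction:
  assumes "orientation k X" "v \<in> cube k" "i \<in> {1..k}"
  shows "arc k X v (flip v i) \<longleftrightarrow> \<not> arc k X (flip v i) v"
proof -
  have "arc k X (flip v i) v \<longleftrightarrow> (X (flip v i) i \<noteq> flip v i i)"
    using arc_flip_iff[OF assms(3), of X "flip v i"] by simp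
  moreover have "X (flip v i) i = X v i"
    using assms by (auto simp: orientation_def)
  moreover have "flip v i i = (\<not> v i)"
    by (simp add: flip_def)
  ultimately show ?thesis
    using arc_flip_iff[OF assms(3), of X v] by auto
qed

end

theory Submission
  imports Defs
begin

text \<open>
  The Szabo--Welzl criterion states that \<open>X\<close> is a USO iff any two distinct vertices \<open>v\<close>, \<open>w\<close>
  differ in some coordinate \<open>i\<close> with \<open>X(v)\<^sub>i = X(w)\<^sub>i\<close>. Now \<open>U \<union> L\<close> is the set of all vertices
  \<open>v\<close> with \<open>K(v)\<^sub>h = 1\<close>, so \<open>K'(v) = K(v*)\<close>, where \<open>v* = v \<oplus> h\<close> if \<open>K(v)\<^sub>h = 1\<close> and \<open>v* = v\<close>
  otherwise. The criterion for \<open>K'\<close> at \<open>v\<close>, \<open>w\<close> follows from that for \<open>K\<close> at \<open>v*\<close>, \<open>w*\<close>: if exactly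
  one of the two vertices is moved, then \<open>K(v*)\<^sub>h \<noteq> K(w*)\<^sub>h\<close>, so the coordinate obtained is
  not \<open>h\<close>, and in it \<open>v\<close> and \<open>w\<close> differ as well.
\<close>

lemma flip_same [simp]: "flip v i i = (\<not> v i)"
  by (simp add: flip_def)

lemma flip_other [simp]: "j \<noteq> i \<Longrightarrow> flip v i j = v j"
  by (simp add: flip_def)

lemma finite_cube: "finite (cube k)"
  unfolding cube_def by (intro finite_PiE) auto

text \<open>A face given by its free coordinates \<open>S\<close> and a base point \<open>b\<close>
  instead of a string: facets are then reached by passing to \<open>S - {h}\<close>, and any vertex
  can serve as base.\<close>

definition subcube :: "nat \<Rightarrow> nat set \<Rightarrow> (nat \<Rightarrow> bool) \<Rightarrow> (nat \<Rightarrow> bool) set" where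
  "subcube k S b = {v \<in> cube k. \<forall>i\<in>{1..k} - S. v i = b i}"

lemma subcube_diff_coord:
  assumes "v \<in> subcube k S b" "w \<in> subcube k S b" "i \<in> {1..k}" "v i \<noteq> w i"
  shows "i \<in> S"
  using assms unfolding subcube_def by (metis (mono_tags, lifting) DiffI mem_Collect_eq)

lemma subcube_flip:
  assumes "S \<subseteq> {1..k}" "v \<in> subcube k S b" "i \<in> {1..k}"
  shows "flip v i \<in> subcube k S b \<longleftrightarrow> i \<in> S"
  using assms flip_in_cube[of v k i] by (auto simp: subcube_def flip_def)

lemma sink_in_subcube_iff:
  assumes "S \<subseteq> {1..k}"
  shows "sink_in k X (subcube k S b) v \<longleftrightarrow> v \<in> subcube k S b \<and> (\<forall>i\<in>S. X v i = v i)"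
proof -
  have "(\<exists>w\<in>subcube k S b. arc k X v w) \<longleftrightarrow> (\<exists>i\<in>S. X v i \<noteq> v i)" if v: "v \<in> subcube k S b"
  proof
    assume "\<exists>w\<in>subcube k S b. arc k X v w"
    then obtain i where "i \<in> {1..k}" "flip v i \<in> subcube k S b" "X v i \<noteq> v i"
      unfolding arc_def by blast
    then show "\<exists>i\<in>S. X v i \<noteq> v i"
      using subcube_flip[OF assms v] by blast
  next
    assume "\<exists>i\<in>S. X v i \<noteq> v i"
    then obtain i where i: "i \<in> S" "X v i \<noteq> v i" by blast
    with assms have "i \<in> {1..k}" by blast
    with i show "\<exists>w\<in>subcube k S b. arc k X v w"
      using subcube_flip[OF assms v] arc_flip_iff[of i k X v] by blast
  qed
  then show ?thesis by (auto simp: sink_in_def)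
qed

lemma face_eq_subcube:
  "face k f = subcube k {i \<in> {1..k}. f i = None} (\<lambda>i. f i = Some True)"
  by (fastforce simp: face_def subcube_def)

lemma subcube_eq_face:
  "subcube k S b = face k (\<lambda>i\<in>{1..k}. if i \<in> S then None else Some (b i))"
  by (auto simp: face_def subcube_def)

lemma USO_iff_subcube:
  "USO k X \<longleftrightarrow> orientation k X \<and>
     (\<forall>S\<subseteq>{1..k}. \<forall>b. \<exists>!v. v \<in> subcube k S b \<and> (\<forall>i\<in>S. X v i = v i))"
  (is "_ \<longleftrightarrow> _ \<and> ?R")
proof -
  have "(\<forall>f\<in>face_strings k. \<exists>!v. sink_in k X (face k f) v) \<longleftrightarrow> ?R"
  proof (intro iffI allI impI ballI)
    fix S b assume sinks: "\<forall>f\<in>face_strings k. \<exists>!v. sink_in k X (face k f) v" and S: "S \<subseteq> {1..k}"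
    have "(\<lambda>i\<in>{1..k}. if i \<in> S then None else Some (b i)) \<in> face_strings k"
      by (simp add: face_strings_def)
    then have "\<exists>!v. sink_in k X (subcube k S b) v"
      using sinks unfolding subcube_eq_face by blast
    then show "\<exists>!v. v \<in> subcube k S b \<and> (\<forall>i\<in>S. X v i = v i)"
      by (simp add: sink_in_subcube_iff[OF S])
  next
    fix f :: "nat \<Rightarrow> bool option" assume R: ?R
    have S: "{i \<in> {1..k}. f i = None} \<subseteq> {1..k}" by blast
    show "\<exists>!v. sink_in k X (face k f) v"
      unfolding face_eq_subcube sink_in_subcube_iff[OF S] using R S by blast
  qed
  then show ?thesis by (simp add: USO_def)
qed

text \<open>
  The induction step amounts to reversing all edges of one dimension \<open>h\<close>. The sink of a subcube is
  the sink \<open>s\<close> of one of its \<open>h\<close>-facets, and the sink \<open>t\<close> of the other \<open>h\<close>-facet has an outgoing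
  \<open>h\<close>-edge; after the reversal, \<open>t\<close> is the only sink.
\<close>

lemma USO_ex1_outset:
  assumes uso: "USO k X" and "finite T" and "T \<subseteq> S" and "S \<subseteq> {1..k}"
  shows "\<exists>!v. v \<in> subcube k S b \<and> (\<forall>i\<in>S. X v i \<noteq> v i \<longleftrightarrow> i \<in> T)"
  using assms(2-)
proof (induction T arbitrary: S b rule: finite_induct)
  case empty
  then show ?case using uso by (simp add: USO_iff_subcube)
next
  case (insert h T)
  \<comment> \<open>With \<open>T' \<subseteq> S'\<close>, these are the sinks after reversing all
    edges of the dimensions in \<open>T'\<close>.\<close>
  define out where "out S' T' v \<longleftrightarrow> (\<forall>i\<in>S'. X v i \<noteq> v i \<longleftrightarrow> i \<in> T')" for S' T' v
  have S: "S \<subseteq> {1..k}" "h \<in> S" "T \<subseteq> S" "T \<subseteq> S - {h}" "S - {h} \<subseteq> {1..k}"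
    using insert.prems insert.hyps by auto
  have whole: "\<exists>!v. v \<in> subcube k S b \<and> out S T v"
    using insert.IH[of S b] S unfolding out_def by blast
  have facet: "\<exists>!v. v \<in> subcube k (S - {h}) c \<and> out (S - {h}) T v" for c
    using insert.IH[of "S - {h}" c] S unfolding out_def by blast
  from whole obtain s where s: "s \<in> subcube k S b" "out S T s" by blast
  from facet obtain t where
    t: "t \<in> subcube k (S - {h}) (flip s h)" "out (S - {h}) T t" by blast
  have h: "h \<in> {1..k}" using S by blast
  have sub: "x \<in> subcube k (S - {h}) s" if "x \<in> subcube k S b" "x h = s h" for x
    using that s by (auto simp: subcube_def)
  have sub': "x \<in> subcube k (S - {h}) (flip s h)" if "x \<in> subcube k S b" "x h \<noteq> s h" for x
    using that s by (auto simp: subcube_def flip_def)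
  have th: "t h \<noteq> s h"
    using t h by (auto simp: subcube_def)
  have tS: "t \<in> subcube k S b"
    using t s S by (auto simp: subcube_def flip_def)
  have sh: "X s h = s h"
    using s S insert.hyps by (auto simp: out_def)
  \<comment> \<open>Uniqueness of \<open>s\<close> rules \<open>t\<close> out; since
    \<open>t\<close> is right in all other dimensions, it must fail at \<open>h\<close>.\<close>
  have "\<not> out S T t"
    using whole s tS th by blast
  then have "X t h \<noteq> t h"
    using t insert.hyps by (auto simp: out_def)
  then have "out S (insert h T) t"
    using t by (auto simp: out_def)
  moreover have "x = t" if x: "x \<in> subcube k S b" "out S (insert h T) x" for x
  proof (cases "x h = s h")
    case True
    have "out (S - {h}) T x" "out (S - {h}) T s"
      using x s by (auto simp: out_def)
    then have "x = s"
      using facet sub[OF x(1) True] sub[OF s(1) refl] by blast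
    moreover have "X x h \<noteq> x h"
      using x S by (auto simp: out_def)
    ultimately show ?thesis using sh by simp
  next
    case False
    have "out (S - {h}) T x"
      using x by (auto simp: out_def)
    then show ?thesis
      using facet sub'[OF x(1) False] t by blast
  qed
  ultimately have "\<exists>!v. v \<in> subcube k S b \<and> out S (insert h T) v"
    using tS by blast
  then show ?case unfolding out_def .
qed

text \<open>Two vertices violating the criterion have the same outgoing dimensions in the face they
  span, contrary to \<open>USO_ex1_outset\<close>. Conversely, the criterion makes the out-map
  injective on each face, hence bijective by finiteness, so a sink exists.\<close>

theorem USO_iff_pairwise:
  "USO k X \<longleftrightarrow> X \<in> cube k \<rightarrow> cube k \<and>
     (\<forall>v\<in>cube k. \<forall>w\<in>cube k. v \<noteq> w \<longrightarrow> (\<exists>i\<in>{1..k}. v i \<noteq> w i \<and> X v i = X w i))"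
proof (intro iffI conjI ballI impI)
  assume "USO k X"
  then show "X \<in> cube k \<rightarrow> cube k"
    by (simp add: USO_def orientation_def)
next
  fix v w assume uso: "USO k X" and v: "v \<in> cube k" and w: "w \<in> cube k" and "v \<noteq> w"
  show "\<exists>i\<in>{1..k}. v i \<noteq> w i \<and> X v i = X w i"
  proof (rule ccontr)
    assume neg: "\<not> ?thesis"
    define S where "S = {i \<in> {1..k}. v i \<noteq> w i}"
    define T where "T = {i \<in> S. X v i \<noteq> v i}"
    have "\<exists>!x. x \<in> subcube k S v \<and> (\<forall>i\<in>S. X x i \<noteq> x i \<longleftrightarrow> i \<in> T)"
      using uso by (intro USO_ex1_outset) (auto simp: S_def T_def)
    moreover have "v \<in> subcube k S v" "w \<in> subcube k S v"
      using v w by (auto simp: subcube_def S_def)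
    moreover have "\<forall>i\<in>S. X v i \<noteq> v i \<longleftrightarrow> i \<in> T" "\<forall>i\<in>S. X w i \<noteq> w i \<longleftrightarrow> i \<in> T"
      using neg by (auto simp: S_def T_def)
    ultimately show False using \<open>v \<noteq> w\<close> by blast
  qed
next
  assume X: "X \<in> cube k \<rightarrow> cube k \<and>
     (\<forall>v\<in>cube k. \<forall>w\<in>cube k. v \<noteq> w \<longrightarrow> (\<exists>i\<in>{1..k}. v i \<noteq> w i \<and> X v i = X w i))"
  then have pair: "\<exists>i\<in>{1..k}. v i \<noteq> w i \<and> X v i = X w i"
    if "v \<in> cube k" "w \<in> cube k" "v \<noteq> w" for v w
    using that by blast
  have "X v i = X (flip v i) i" if vi: "v \<in> cube k" "i \<in> {1..k}" for v i
  proof -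
    \<comment> \<open>The two vertices differ only in \<open>i\<close>, so the criterion can only
      yield \<open>i\<close>.\<close>
    have "v \<noteq> flip v i" by (metis flip_same)
    then obtain j where "v j \<noteq> flip v i j" "X v j = X (flip v i) j"
      using pair[OF vi(1) flip_in_cube[OF vi]] by blast
    then show ?thesis by (cases "j = i") auto
  qed
  then have "orientation k X"
    using X by (simp add: orientation_def)
  moreover have "\<exists>!v. v \<in> subcube k S b \<and> (\<forall>i\<in>S. X v i = v i)" if S: "S \<subseteq> {1..k}" for S b
  proof -
    \<comment> \<open>The out-map of the face: free coordinates become out-bits, fixed ones are kept
      so that \<open>g\<close> stays in the face.\<close>
    define g where "g v = (\<lambda>i. if i \<in> S then X v i \<noteq> v i else v i)" for v
    have "finite (subcube k S b)"
      using finite_cube by (rule rev_finite_subset) (auto simp: subcube_def)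
    moreover have "g ` subcube k S b \<subseteq> subcube k S b"
      using S by (auto simp: g_def subcube_def cube_def PiE_iff extensional_def)
    moreover have "inj_on g (subcube k S b)"
    proof (rule inj_onI, rule ccontr)
      fix v w assume vw: "v \<in> subcube k S b" "w \<in> subcube k S b" "g v = g w" "v \<noteq> w"
      then obtain i where i: "i \<in> {1..k}" "v i \<noteq> w i" "X v i = X w i"
        using pair[of v w] unfolding subcube_def by blast
      then have "i \<in> S" using subcube_diff_coord vw by blast
      with i fun_cong[OF vw(3), of i] show False by (auto simp: g_def)
    qed
    ultimately have surj: "g ` subcube k S b = subcube k S b"
      by (rule endo_inj_surj)
    \<comment> \<open>All free coordinates are 0, so a preimage of \<open>z\<close> under
      \<open>g\<close> is a sink.\<close>
    define z where "z = (\<lambda>i\<in>{1..k}. i \<notin> S \<and> b i)"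
    have "z \<in> subcube k S b"
      by (auto simp: z_def subcube_def cube_def)
    then obtain v where v: "v \<in> subcube k S b" "g v = z"
      using surj by (metis imageE)
    have "X v i = v i" if "i \<in> S" for i
      using fun_cong[OF v(2), of i] that S by (auto simp: g_def z_def)
    moreover have "w = v" if w: "w \<in> subcube k S b" "\<forall>i\<in>S. X w i = w i" for w
    \<comment> \<open>At two sinks \<open>X\<close> equals the vertex on \<open>S\<close>, so they
      cannot differ in a coordinate where \<open>X\<close> agrees.\<close>
    proof (rule ccontr)
      assume "w \<noteq> v"
      then obtain i where i: "i \<in> {1..k}" "w i \<noteq> v i" "X w i = X v i"
        using pair[of w v] v w unfolding subcube_def by blast
      then have "i \<in> S" using subcube_diff_coord v w by blast
      with i calculation w(2) show False by metis
    qed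
    ultimately show ?thesis using v by blast
  qed
  ultimately show "USO k X"
    by (simp add: USO_iff_subcube)
qed

theorem theorem18:
  fixes k h :: nat
    and K K' :: "(nat \<Rightarrow> bool) \<Rightarrow> (nat \<Rightarrow> bool)"
    and U L :: "(nat \<Rightarrow> bool) set"
  assumes "USO k K"
    and "h \<in> {1..k}"
    and "U = {v \<in> upper_facet k h. K v h}"
    and "L = {flip v h | v. v \<in> U}"
    and "K' = (\<lambda>v. if v \<in> U \<union> L then K (flip v h) else K v)"
  shows "orientation k K' \<and> USO k K'"
proof -
  have edge: "K (flip v h) h = K v h" if "v \<in> cube k" for v
    using assms(1,2) that by (auto simp: USO_def orientation_def)
  have UL: "v \<in> U \<union> L \<longleftrightarrow> K v h" if v: "v \<in> cube k" for v
  proof -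
    \<comment> \<open>\<open>U\<close> and \<open>L\<close> collect the upper and lower ends of the
      upward \<open>h\<close>-edges, and both ends carry the same bit.\<close>
    have "v \<in> L \<longleftrightarrow> flip v h \<in> U"
      unfolding assms(4) by (auto intro: exI[of _ "flip v h"])
    then show ?thesis
      using v edge[OF v] flip_in_cube[OF v assms(2)]
      by (auto simp: assms(3) upper_facet_def)
  qed
  define m where "m v = (if K v h then flip v h else v)" for v
  have K': "K' v = K (m v)" if "v \<in> cube k" for v
    using UL[OF that] by (simp add: assms(5) m_def)
  have m_cube: "m v \<in> cube k" if "v \<in> cube k" for v
    using that flip_in_cube assms(2) by (simp add: m_def)
  have m_dir: "K (m v) h = K v h" if "v \<in> cube k" for v
    using edge[OF that] by (simp add: m_def)
  have m_other: "m v i = v i" if "i \<noteq> h" for v i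
    using that by (simp add: m_def)
  have m_diff: "m v h \<noteq> m w h \<longleftrightarrow> v h \<noteq> w h" if "K v h = K w h" for v w
    using that by (auto simp: m_def)
  have K: "K \<in> cube k \<rightarrow> cube k"
    and pair: "\<And>v w. v \<in> cube k \<Longrightarrow> w \<in> cube k \<Longrightarrow> v \<noteq> w \<Longrightarrow>
      \<exists>i\<in>{1..k}. v i \<noteq> w i \<and> K v i = K w i"
    using assms(1) unfolding USO_iff_pairwise by blast+
  have "\<exists>i\<in>{1..k}. v i \<noteq> w i \<and> K' v i = K' w i"
    if v: "v \<in> cube k" and w: "w \<in> cube k" and "v \<noteq> w" for v w
  proof -
    \<comment> \<open>By \<open>m_dir\<close>, \<open>m\<close> preserves the bit deciding whether
      to flip, so it is an involution on the cube.\<close>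
    have "m v \<noteq> m w"
      using m_dir[OF v] m_dir[OF w] \<open>v \<noteq> w\<close> by (metis flip_flip m_def)
    then obtain i where i: "i \<in> {1..k}" "m v i \<noteq> m w i" "K (m v) i = K (m w) i"
      using pair[OF m_cube[OF v] m_cube[OF w]] by blast
    \<comment> \<open>If \<open>i = h\<close>, then \<open>m_dir\<close> gives
      \<open>K v h = K w h\<close> and \<open>m_diff\<close> applies; otherwise
      \<open>m_other\<close> does.\<close>
    have "v i \<noteq> w i"
      using i m_dir[OF v] m_dir[OF w] m_diff m_other by metis
    then show ?thesis using i K' v w by auto
  qed
  moreover have "K' \<in> cube k \<rightarrow> cube k"
    using K K' m_cube by auto
  ultimately have "USO k K'"
    unfolding USO_iff_pairwise by blast
  then show ?thesis by (simp add: USO_def)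
qed

end
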